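(* (Concentration Inequality) Let $\mathbf X=(X,\mathcal E)$ and $\mathbf Y=(Y,\mathcal F)$ be coarse spaces with modules $\mathcal H_{\mathbf X}$ and $\mathcal H_{\mathbf Y}$. Let $\mathcal H_{\mathbf X}$ be discrete with discreteness gauge $\widetilde E$, and let $T\colon\mathcal H_{\mathbf X}\to\mathcal H_{\mathbf Y}$ be a bounded operator that is $\eta$-bounded from below for some $\eta>0$. Fix $\delta,\kappa>0$, $F\in\mathcal F$ and measurable $B,C\subseteq Y$ with $F(B)\subseteq C$ and $\|1_BT\|\ge\kappa$. Suppose that $\|1_CT1_A\|\le\delta$ for every measurable $\widetilde E$-bounded $A\subseteq X$. Then for every $\varepsilon>0$ such that \[ \varepsilon<\frac{\kappa^2(\eta^2-\delta^2)^{1/2}}{2\|T\|} \] there is a projection $p\in\mathcal B(\mathcal H_{\mathbf X})$ of $\widetilde E$-controlled propagation whose image $TpT^*$ under ${\rm Ad}(T)$ is not $\varepsilon$-$F$-quasi-local.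
   Context: A coarse structure on a set $X$ is a family $\mathcal E$ of subsets of $X\times X$ (entourages) closed under subsets, finite unions, transposition and composition of relations, and containing the diagonal; $(X,\mathcal E)$ is a coarse space. For $E\subseteq X\times X$, $A\subseteq X$ let $E(A)=\{y\mid\exists x\in A,(y,x)\in E\}$; $A$ is $E$-bounded if $A\times A\subseteq E$. A gauge is a symmetric entourage containing the diagonal. Projection means self-adjoint idempotent. A module $\mathcal H_{\mathbf X}$ over $\mathbf X$ is a Hilbert space with a unital Boolean algebra $\mathfrak A$ of subsets of $X$ (measurable sets) and a map $A\mapsto1_A$ from $\mathfrak A$ to projections with $1_{A\cap A'}=1_A1_{A'}$, $1_{A\sqcup A'}=1_A+1_{A'}$ for disjoint sets, $1_X=\mathrm{id}$, and such that for some gauge $\widetilde E$ the subspaces $1_A(\mathcal H_{\mathbf X})$, $A$ measurable $\widetilde E$-bounded, span a dense subspace. It is discrete with discreteness gauge $\widetilde E$ if $\widetilde E$ is a gauge and there is a partition $X=\bigsqcup_iA_i$ into $\widetilde E$-bounded measurable sets with $\sum_i1_{A_i}=1$ strongly and such that $C\subseteq X$ is measurable whenever all $C\cap A_i$ are. $T$ is $\eta$-bounded from below if $\|Tv\|\ge\eta\|v\|$ for all $v$. An operator $t\in\mathcal B(\mathcal H_{\mathbf X})$ has $E$-controlled propagation if $1_{A'}t1_A=0$ for all measurable $A,A'$ with $A'\cap E(A)=\emptyset$. An operator $s\in\mathcal B(\mathcal H_{\mathbf Y})$ is $\varepsilon$-$F$-quasi-local if $\|1_{B'}s1_{B}\|\le\varepsilon$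 for all measurable $B,B'\subseteq Y$ with $B'\cap F(B)=\emptyset$. *)

theory Defs
  imports "HOL-Analysis.Analysis"
begin

section \<open>Complex Hilbert spaces\<close>

text \<open>
  A complex Hilbert space is a Banach space with a compatible complex structure and a sesquilinear
  form inducing its norm; the form is linear in its first argument. Positive definiteness follows
  from the last axiom. Trivial spaces are allowed.
\<close>

class complex_hilbert = banach +
  fixes scaleC :: "complex \<Rightarrow> 'a \<Rightarrow> 'a"  (infixr \<open>*\<^sub>C\<close> 75)
    and cinner :: "'a \<Rightarrow> 'a \<Rightarrow> complex"
  assumes scaleC_add_right: "a *\<^sub>C (x + y) = a *\<^sub>C x + a *\<^sub>C y"
    and scaleC_add_left: "(a + b) *\<^sub>C x = a *\<^sub>C x + b *\<^sub>C x"
    and scaleC_scaleC: "a *\<^sub>C (b *\<^sub>C x) = (a * b) *\<^sub>C x"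
    and scaleC_of_real: "complex_of_real r *\<^sub>C x = r *\<^sub>R x"
    and cinner_add_left: "cinner (x + y) z = cinner x z + cinner y z"
    and cinner_scaleC_left: "cinner (a *\<^sub>C x) y = a * cinner x y"
    and cinner_commute: "cinner y x = cnj (cinner x y)"
    and cinner_self: "cinner x x = complex_of_real ((norm x)\<^sup>2)"

definition bounded_clinear :: "('a::complex_hilbert \<Rightarrow> 'b::complex_hilbert) \<Rightarrow> bool" where
  "bounded_clinear T \<longleftrightarrow> bounded_linear T \<and> (\<forall>c x. T (c *\<^sub>C x) = c *\<^sub>C T x)"

definition is_cadjoint ::
    "('a::complex_hilbert \<Rightarrow> 'b::complex_hilbert) \<Rightarrow> ('b \<Rightarrow> 'a) \<Rightarrow> bool" where
  "is_cadjoint T S \<longleftrightarrow> (\<forall>x y. cinner (T x) y = cinner x (S y))"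

text \<open>An adjoint is unique whenever it exists, and it exists for \<^term>\<open>bounded_clinear T\<close> by the
  Riesz representation theorem.\<close>

definition cadjoint :: "('a::complex_hilbert \<Rightarrow> 'b::complex_hilbert) \<Rightarrow> 'b \<Rightarrow> 'a" where
  "cadjoint T = (THE S. is_cadjoint T S)"

definition is_projection :: "('a::complex_hilbert \<Rightarrow> 'a) \<Rightarrow> bool" where
  "is_projection p \<longleftrightarrow> bounded_clinear p \<and> is_cadjoint p p \<and> p \<circ> p = p"

definition bounded_below :: "real \<Rightarrow> ('a::complex_hilbert \<Rightarrow> 'b::complex_hilbert) \<Rightarrow> bool" where
  "bounded_below \<eta> T \<longleftrightarrow> (\<forall>v. norm (T v) \<ge> \<eta> * norm v)"


section \<open>Coarse spaces\<close>

locale coarse_space =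
  fixes X :: "'x set" and \<E> :: "('x \<times> 'x) set set"
  assumes entourage_subset_carrier: "E \<in> \<E> \<Longrightarrow> E \<subseteq> X \<times> X"
    and entourage_diagonal: "Id_on X \<in> \<E>"
    and entourage_subset: "E \<in> \<E> \<Longrightarrow> E' \<subseteq> E \<Longrightarrow> E' \<in> \<E>"
    and entourage_Un: "E \<in> \<E> \<Longrightarrow> E' \<in> \<E> \<Longrightarrow> E \<union> E' \<in> \<E>"
    and entourage_converse: "E \<in> \<E> \<Longrightarrow> E\<inverse> \<in> \<E>"
    and entourage_relcomp: "E \<in> \<E> \<Longrightarrow> E' \<in> \<E> \<Longrightarrow> E O E' \<in> \<E>"

text \<open>Note the orientation: this is \<open>E\<inverse> `` A\<close>.\<close>

definition thicken :: "('x \<times> 'x) set \<Rightarrow> 'x set \<Rightarrow> 'x set" where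
  "thicken E A = {y. \<exists>x\<in>A. (y, x) \<in> E}"

definition ent_bounded :: "('x \<times> 'x) set \<Rightarrow> 'x set \<Rightarrow> bool" where
  "ent_bounded E A \<longleftrightarrow> A \<times> A \<subseteq> E"

definition coarse_gauge :: "'x set \<Rightarrow> ('x \<times> 'x) set set \<Rightarrow> ('x \<times> 'x) set \<Rightarrow> bool" where
  "coarse_gauge X \<E> E \<longleftrightarrow> E \<in> \<E> \<and> sym E \<and> Id_on X \<subseteq> E"


section \<open>Modules over coarse spaces\<close>

text \<open>
  The Hilbert space is the type \<^typ>\<open>'h\<close>; \<open>ind A\<close> is the projection \<open>1\<^sub>A\<close>, and only its values
  on the Boolean algebra \<open>\<AA>\<close> of measurable sets are relevant.
\<close>

locale coarse_module = coarse_space X \<E> + algebra X \<AA>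
  for X :: "'x set" and \<E> :: "('x \<times> 'x) set set" and \<AA> :: "'x set set" +
  fixes ind :: "'x set \<Rightarrow> 'h::complex_hilbert \<Rightarrow> 'h"
  assumes ind_projection: "A \<in> \<AA> \<Longrightarrow> is_projection (ind A)"
    and ind_Int: "A \<in> \<AA> \<Longrightarrow> A' \<in> \<AA> \<Longrightarrow> ind (A \<inter> A') = ind A \<circ> ind A'"
    and ind_disjoint_Un:
      "A \<in> \<AA> \<Longrightarrow> A' \<in> \<AA> \<Longrightarrow> A \<inter> A' = {} \<Longrightarrow> ind (A \<union> A') = (\<lambda>v. ind A v + ind A' v)"
    and ind_carrier: "ind X = id"
    and nondegenerate: "\<exists>E. coarse_gauge X \<E> E \<and>
      closure (module.span scaleC (\<Union>A\<in>{A \<in> \<AA>. ent_bounded E A}. range (ind A))) = UNIV"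

text \<open>\<open>E\<close> is a discreteness gauge: \<^const>\<open>has_sum\<close> at every vector expresses strong convergence.\<close>

definition discrete_with_gauge ::
    "'x set \<Rightarrow> ('x \<times> 'x) set set \<Rightarrow> 'x set set \<Rightarrow> ('x set \<Rightarrow> 'h::complex_hilbert \<Rightarrow> 'h)
      \<Rightarrow> ('x \<times> 'x) set \<Rightarrow> bool" where
  "discrete_with_gauge X \<E> \<AA> ind E \<longleftrightarrow> coarse_gauge X \<E> E \<and>
    (\<exists>P. partition_on X P \<and> P \<subseteq> \<AA> \<and> (\<forall>A\<in>P. ent_bounded E A) \<and>
      (\<forall>v. ((\<lambda>A. ind A v) has_sum v) P) \<and>
      (\<forall>C\<subseteq>X. (\<forall>A\<in>P. C \<inter> A \<in> \<AA>) \<longrightarrow> C \<in> \<AA>))"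

definition controlled_propagation ::
    "'x set set \<Rightarrow> ('x set \<Rightarrow> 'h::complex_hilbert \<Rightarrow> 'h) \<Rightarrow> ('x \<times> 'x) set \<Rightarrow> ('h \<Rightarrow> 'h) \<Rightarrow> bool" where
  "controlled_propagation \<AA> ind E t \<longleftrightarrow>
    (\<forall>A\<in>\<AA>. \<forall>A'\<in>\<AA>. A' \<inter> thicken E A = {} \<longrightarrow> ind A' \<circ> t \<circ> ind A = (\<lambda>_. 0))"

definition quasi_local ::
    "'x set set \<Rightarrow> ('x set \<Rightarrow> 'h::complex_hilbert \<Rightarrow> 'h) \<Rightarrow> real \<Rightarrow> ('x \<times> 'x) set \<Rightarrow> ('h \<Rightarrow> 'h) \<Rightarrow> bool"
  where
  "quasi_local \<AA> ind \<epsilon> F s \<longleftrightarrow>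
    (\<forall>B\<in>\<AA>. \<forall>B'\<in>\<AA>. B' \<inter> thicken F B = {} \<longrightarrow> onorm (ind B' \<circ> s \<circ> ind B) \<le> \<epsilon>)"

end

theory Submission
  imports Defs
begin

text \<open>
  Put \<open>D = Y - C\<close>. Since \<open>\<parallel>1\<^sub>B T\<parallel> \<ge> \<kappa>\<close>, some \<open>w\<close> in the range of \<open>1\<^sub>B\<close> has
  \<open>\<parallel>T\<^sup>* w\<parallel> > \<kappa>' \<parallel>w\<parallel>\<close> for any given \<open>\<kappa>' < \<kappa>\<close>. Cut \<open>u = T\<^sup>* w\<close> into the pieces \<open>u\<^sub>i = 1\<^bsub>A\<^sub>i\<^esub> u\<close>
  of the discrete partition, keeping finitely many of them. Each piece satisfies
  \<open>\<parallel>1\<^sub>D T u\<^sub>i\<parallel>\<^sup>2 = \<parallel>T u\<^sub>i\<parallel>\<^sup>2 - \<parallel>1\<^sub>C T u\<^sub>i\<parallel>\<^sup>2 \<ge> (\<eta>\<^sup>2 - \<delta>\<^sup>2) \<parallel>u\<^sub>i\<parallel>\<^sup>2\<close>. By the parallelogram law, signs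
  can be chosen such that \<open>\<parallel>\<Sum> \<plusminus> 1\<^sub>D T u\<^sub>i\<parallel>\<^sup>2\<close> is at least the sum of the squares, so the
  pieces with sign \<open>+\<close> or those with sign \<open>-\<close> contribute at least half of the norm. The union
  \<open>U\<close> of these \<open>A\<^sub>i\<close> gives the projection \<open>p = 1\<^sub>U\<close>. The resulting constant \<open>\<kappa> / 2\<close> is at least
  \<open>\<kappa>\<^sup>2 / (2 \<parallel>T\<parallel>)\<close>.
\<close>

section \<open>Hilbert space geometry\<close>

lemma cinner_add_right:
  fixes x y z :: "'a::complex_hilbert"
  shows "cinner x (y + z) = cinner x y + cinner x z"
  by (metis cinner_add_left cinner_commute complex_cnj_add)

lemma cinner_scaleC_right:
  fixes x y :: "'a::complex_hilbert"
  shows "cinner x (a *\<^sub>C y) = cnj a * cinner x y"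
  by (metis cinner_commute cinner_scaleC_left complex_cnj_mult)

lemma cinner_scaleR_left:
  fixes x y :: "'a::complex_hilbert"
  shows "cinner (r *\<^sub>R x) y = of_real r * cinner x y"
  by (metis cinner_scaleC_left scaleC_of_real)

lemma cinner_scaleR_right:
  fixes x y :: "'a::complex_hilbert"
  shows "cinner x (r *\<^sub>R y) = of_real r * cinner x y"
  by (metis cinner_scaleC_right scaleC_of_real complex_cnj_complex_of_real)

lemma cinner_minus_left:
  fixes x y :: "'a::complex_hilbert"
  shows "cinner (- x) y = - cinner x y"
  using cinner_scaleR_left[of "-1" x y] by simp

lemma cinner_minus_right:
  fixes x y :: "'a::complex_hilbert"
  shows "cinner x (- y) = - cinner x y"
  using cinner_scaleR_right[of x "-1" y] by simp

lemma cinner_diff_right: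
  fixes x y z :: "'a::complex_hilbert"
  shows "cinner x (y - z) = cinner x y - cinner x z"
  using cinner_add_right[of x y "- z"] by (simp add: cinner_minus_right)

lemma Re_cinner_commute:
  fixes x y :: "'a::complex_hilbert"
  shows "Re (cinner y x) = Re (cinner x y)"
  by (subst cinner_commute) simp

lemma norm_add_sq:
  fixes x y :: "'a::complex_hilbert"
  shows "(norm (x + y))\<^sup>2 = (norm x)\<^sup>2 + 2 * Re (cinner x y) + (norm y)\<^sup>2"
proof -
  have "(norm (x + y))\<^sup>2 = Re (cinner (x + y) (x + y))"
    by (simp only: cinner_self Re_complex_of_real)
  also have "\<dots> = (norm x)\<^sup>2 + 2 * Re (cinner x y) + (norm y)\<^sup>2"
    unfolding cinner_add_left cinner_add_right
    by (simp add: cinner_self Re_cinner_commute[of y x])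
  finally show ?thesis .
qed

lemma norm_diff_sq:
  fixes x y :: "'a::complex_hilbert"
  shows "(norm (x - y))\<^sup>2 = (norm x)\<^sup>2 - 2 * Re (cinner x y) + (norm y)\<^sup>2"
  using norm_add_sq[of x "- y"] by (simp add: cinner_minus_right)

text \<open>Cauchy-Schwarz for real parts: rescale both vectors to norm
  \<open>norm x * norm y\<close> and expand the square of their difference. What remains is the
  defect of the inequality times a factor that is positive only for nonzero vectors, hence the case
  split.\<close>

lemma Re_cinner_le:
  fixes x y :: "'a::complex_hilbert"
  shows "Re (cinner x y) \<le> norm x * norm y"
proof (cases "x = 0 \<or> y = 0")
  case True
  then show ?thesis
    using cinner_scaleR_left[of 0 x y] cinner_scaleR_right[of x 0 y] by auto
next
  case False
  have "0 \<le> (norm (norm y *\<^sub>R x - norm x *\<^sub>R y))\<^sup>2" by simp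
  also have "\<dots> = 2 * (norm x * norm y) * (norm x * norm y - Re (cinner x y))"
    unfolding norm_diff_sq
    by (simp add: cinner_scaleR_left cinner_scaleR_right power2_eq_square algebra_simps)
  finally show ?thesis
    using mult_left_le_imp_le[of "2 * (norm x * norm y)" 0 "norm x * norm y - Re (cinner x y)"]
      False by simp
qed

lemma cinner_ext:
  fixes u v :: "'a::complex_hilbert"
  assumes "\<And>x. cinner x u = cinner x v"
  shows "u = v"
proof -
  have "cinner (u - v) (u - v) = 0"
    by (simp add: cinner_diff_right[of "u - v"] assms)
  then show ?thesis by (simp add: cinner_self)
qed

section \<open>Riesz representation and adjoints\<close>

lemma riesz_representation:
  fixes f :: "'a::complex_hilbert \<Rightarrow> complex"
  assumes add: "\<And>x y. f (x + y) = f x + f y"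
    and scale: "\<And>c x. f (c *\<^sub>C x) = c * f x"
    and bound: "\<And>x. Re (f x) \<le> K * norm x"
  shows "\<exists>u. \<forall>x. f x = cinner x u"
proof -
  \<comment> \<open>The representing vector is the minimizer of \<open>J\<close>.\<close>
  define J where "J x = (norm x)\<^sup>2 - 2 * Re (f x)" for x
  have scaleR: "f (r *\<^sub>R x) = of_real r * f x" for r x
    by (metis scale scaleC_of_real)
  have minus: "f (- x) = - f x" for x
    using scaleR[of "-1" x] by simp
  have lower: "- K\<^sup>2 \<le> J x" for x
  proof -
    have "0 \<le> (norm x - K)\<^sup>2" by simp
    then show ?thesis using bound[of x] by (simp add: J_def power2_eq_square algebra_simps)
  qed
  define m where "m = Inf (range J)"
  have bdd: "bdd_below (range J)" using lower by (auto intro: bdd_belowI[of _ "- K\<^sup>2"])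
  have m_le: "m \<le> J x" for x
    unfolding m_def by (rule cInf_lower[OF _ bdd]) simp
  have "\<exists>x. J x < m + 1 / Suc n" for n
  proof -
    have "Inf (range J) < m + 1 / Suc n" by (simp add: m_def)
    then show ?thesis using cInf_less_iff[OF _ bdd, of "m + 1 / Suc n"] by auto
  qed
  then obtain x where x: "\<And>n. J (x n) < m + 1 / Suc n" by metis
  \<comment> \<open>The linear terms cancel. As \<open>J\<close> is at least \<open>m\<close> at the
    midpoint, two nearly minimal points are close to each other.\<close>
  have parallelogram: "(norm (a - b))\<^sup>2 = 2 * J a + 2 * J b - 4 * J ((1/2) *\<^sub>R (a + b))" for a b
    unfolding J_def norm_scaleR power_mult_distrib scaleR add norm_add_sq norm_diff_sq
    by (simp add: power2_eq_square field_simps)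
  have close: "(norm (x i - x j))\<^sup>2 < 2 / Suc i + 2 / Suc j" for i j
    using x[of i] x[of j] m_le[of "(1/2) *\<^sub>R (x i + x j)"] by (simp add: parallelogram)
  have "Cauchy x"
  proof (rule metric_CauchyI)
    fix e :: real assume "0 < e"
    obtain N :: nat where N: "4 / e\<^sup>2 < Suc N"
      using reals_Archimedean2[of "4 / e\<^sup>2"] by (meson lessI less_trans of_nat_less_iff)
    have "dist (x i) (x j) < e" if "i \<ge> N" "j \<ge> N" for i j
    proof -
      have "2 / real (Suc i) \<le> 2 / Suc N" "2 / real (Suc j) \<le> 2 / Suc N"
        using that by (auto intro!: divide_left_mono)
      then have "(norm (x i - x j))\<^sup>2 < 4 / Suc N" using close[of i j] by simp
      also have "\<dots> < e\<^sup>2" using N \<open>0 < e\<close> by (simp add: field_simps)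
      finally show ?thesis using \<open>0 < e\<close> by (simp add: dist_norm power_less_imp_less_base)
    qed
    then show "\<exists>M. \<forall>i\<ge>M. \<forall>j\<ge>M. dist (x i) (x j) < e" by blast
  qed
  then obtain u where u: "x \<longlonglongrightarrow> u" using Cauchy_convergent convergentD by blast
  have "bounded_linear (\<lambda>x. Re (f x))"
  proof (rule bounded_linear_intro)
    show "norm (Re (f x)) \<le> norm x * K" for x
      using bound[of x] bound[of "- x"] by (simp add: minus abs_le_iff mult.commute)
  qed (simp_all add: add scaleR)
  then have "(\<lambda>n. J (x n)) \<longlonglongrightarrow> J u"
    unfolding J_def by (intro tendsto_intros u bounded_linear.tendsto[of "\<lambda>x. Re (f x)"])
  moreover have "(\<lambda>n. m + 1 / Suc n) \<longlonglongrightarrow> m"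
    using tendsto_add[OF tendsto_const LIMSEQ_Suc[OF lim_1_over_n]] by simp
  ultimately have "J u \<le> m"
    by (rule LIMSEQ_le) (use x less_imp_le in blast)
  then have minimal: "J u \<le> J y" for y using m_le order_trans by blast
  have Re_le: "Re (f h) \<le> Re (cinner h u)" for h
  proof (rule ccontr)
    define d where "d = Re (f h) - Re (cinner h u)"
    assume "\<not> ?thesis"
    then have d: "d > 0" by (simp add: d_def)
    have pos: "1 + (norm h)\<^sup>2 > 0" by (simp add: add_pos_nonneg)
    \<comment> \<open>Moving from \<open>u\<close> by \<open>t\<close> along \<open>h\<close>
      changes \<open>J\<close> by a quadratic in \<open>t\<close> with slope \<open>-2 * d\<close>
      at 0, so a small step decreases it. The summand 1 in the denominator covers
      \<open>h = 0\<close>.\<close>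
    define t where "t = d / (1 + (norm h)\<^sup>2)"
    have t: "t > 0" "t * (norm h)\<^sup>2 < d" using d pos by (auto simp: t_def field_simps)
    have "J (u + t *\<^sub>R h) = J u + t * (t * (norm h)\<^sup>2 - 2 * d)"
      unfolding J_def norm_add_sq add scaleR
      by (simp add: cinner_scaleR_right Re_cinner_commute[of h u] d_def power_mult_distrib
          power2_eq_square algebra_simps)
    moreover have "t * (t * (norm h)\<^sup>2 - 2 * d) < 0"
      using t d by (intro mult_pos_neg) auto
    ultimately show False using minimal[of "u + t *\<^sub>R h"] by simp
  qed
  have Re_eq: "Re (f h) = Re (cinner h u)" for h
    using Re_le[of h] Re_le[of "- h"] by (simp add: minus cinner_minus_left)
  \<comment> \<open>Both sides are complex linear in \<open>h\<close>, so the real parts at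
    \<open>\<i> *\<^sub>C h\<close> are minus the imaginary parts at \<open>h\<close>.\<close>
  have "Im (f h) = Im (cinner h u)" for h
    using Re_eq[of "\<i> *\<^sub>C h"] by (simp add: scale cinner_scaleC_left)
  then show ?thesis using Re_eq complex_eqI by blast
qed

text \<open>Riesz, applied to the functional \<open>\<lambda>x. cinner (T x) y\<close> for each
  \<open>y\<close>, gives existence; definiteness of the form gives uniqueness, so the description
  \<open>THE\<close> denotes the adjoint.\<close>

lemma is_cadjoint_cadjoint:
  fixes T :: "'a::complex_hilbert \<Rightarrow> 'b::complex_hilbert"
  assumes "bounded_clinear T"
  shows "is_cadjoint T (cadjoint T)"
proof -
  interpret bounded_linear T using assms by (simp add: bounded_clinear_def)
  have "\<exists>u. \<forall>x. cinner (T x) y = cinner x u" for y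
  proof (rule riesz_representation)
    show "Re (cinner (T x) y) \<le> (onorm T * norm y) * norm x" for x
      using Re_cinner_le[of "T x" y] mult_right_mono[OF onorm[OF bounded_linear_axioms, of x], of "norm y"]
      by (simp add: algebra_simps)
  qed (use assms in \<open>simp_all add: add cinner_add_left cinner_scaleC_left bounded_clinear_def\<close>)
  then obtain S where S: "is_cadjoint T S" unfolding is_cadjoint_def by metis
  moreover have "R = S" if "is_cadjoint T R" for R
  proof
    show "R y = S y" for y
      by (rule cinner_ext) (metis that S is_cadjoint_def)
  qed
  ultimately show ?thesis unfolding cadjoint_def by (rule theI)
qed

lemma bounded_linear_cadjoint:
  fixes T :: "'a::complex_hilbert \<Rightarrow> 'b::complex_hilbert"
  assumes "bounded_clinear T"
  shows "bounded_linear (cadjoint T)"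
proof (rule bounded_linear_intro)
  let ?S = "cadjoint T"
  have T: "bounded_linear T" using assms by (simp add: bounded_clinear_def)
  have adj: "cinner (T x) y = cinner x (?S y)" for x y
    using is_cadjoint_cadjoint[OF assms] by (simp add: is_cadjoint_def)
  show "?S (x + y) = ?S x + ?S y" for x y
    by (rule cinner_ext) (simp add: cinner_add_right flip: adj)
  show "?S (r *\<^sub>R x) = r *\<^sub>R ?S x" for r x
    by (rule cinner_ext) (simp add: cinner_scaleR_right flip: adj)
  show "norm (?S y) \<le> norm y * onorm T" for y
  proof (cases "?S y = 0")
    case True
    then show ?thesis using onorm_pos_le[OF T] by simp
  next
    case False
    have "(norm (?S y))\<^sup>2 = Re (cinner (T (?S y)) y)"
      by (simp add: adj cinner_self)
    also have "\<dots> \<le> norm (T (?S y)) * norm y" by (rule Re_cinner_le)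
    also have "\<dots> \<le> (onorm T * norm (?S y)) * norm y"
      by (intro mult_right_mono onorm[OF T]) simp
    finally show ?thesis using False by (simp add: power2_eq_square mult_ac)
  qed
qed

section \<open>Norms of projected vectors and choice of signs\<close>

lemma is_projection_bounded_linear: "is_projection p \<Longrightarrow> bounded_linear p"
  by (simp add: is_projection_def bounded_clinear_def)

text \<open>Makes the squared norm of \<open>p v\<close> additive in \<open>p\<close>, so that
  additivity of \<open>ind\<close> on disjoint sets yields Pythagoras without a separate treatment
  of orthogonality.\<close>

lemma cinner_projection_self:
  assumes "is_projection p"
  shows "cinner (p v) v = complex_of_real ((norm (p v))\<^sup>2)"
  using assms unfolding is_projection_def is_cadjoint_def
  by (metis cinner_self comp_apply)

text \<open>Signs are chosen greedily: the next vector gets the sign that makes its cross term with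
  the signed sum so far nonnegative. \<open>S\<close> collects the indices with sign plus.\<close>

lemma exists_signs_sum_norm_sq_le:
  fixes x :: "'i \<Rightarrow> 'a::complex_hilbert"
  assumes "finite I"
  shows "\<exists>S\<subseteq>I. (\<Sum>i\<in>I. (norm (x i))\<^sup>2) \<le> (norm (sum x S - sum x (I - S)))\<^sup>2"
  using assms
proof (induction I)
  case empty
  then show ?case by simp
next
  case (insert j I)
  then obtain S where S: "S \<subseteq> I"
    "(\<Sum>i\<in>I. (norm (x i))\<^sup>2) \<le> (norm (sum x S - sum x (I - S)))\<^sup>2" by blast
  define a where "a = sum x S - sum x (I - S)"
  have j: "j \<notin> S" "finite S" using S insert finite_subset by auto
  show ?case
  proof (cases "Re (cinner a (x j)) \<ge> 0")
    case True
    have "insert j I - insert j S = I - S" using insert.hyps by auto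
    then have "sum x (insert j S) - sum x (insert j I - insert j S) = a + x j"
      using j by (simp add: a_def)
    moreover have "(\<Sum>i\<in>insert j I. (norm (x i))\<^sup>2) \<le> (norm (a + x j))\<^sup>2"
      using True S insert.hyps by (simp add: norm_add_sq a_def)
    ultimately show ?thesis using S by (intro exI[of _ "insert j S"]) auto
  next
    case False
    have "insert j I - S = insert j (I - S)" using j by auto
    then have "sum x S - sum x (insert j I - S) = a - x j"
      using insert.hyps by (simp add: a_def)
    moreover have "(\<Sum>i\<in>insert j I. (norm (x i))\<^sup>2) \<le> (norm (a - x j))\<^sup>2"
      using False S insert.hyps by (simp add: norm_diff_sq a_def)
    ultimately show ?thesis using S by (intro exI[of _ S]) auto
  qed
qed

section \<open>Modules over coarse spaces\<close>

context coarse_module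
begin

lemma ind_empty: "ind {} = (\<lambda>_. 0)"
proof
  \<comment> \<open>The empty set is disjoint from itself, so \<open>ind {} v\<close> equals its own
    double.\<close>
  show "ind {} v = 0" for v using fun_cong[OF ind_disjoint_Un[of "{}" "{}"], of v] by simp
qed

lemma ind_Union_disjoint:
  assumes "finite I" "I \<subseteq> \<AA>" "disjoint I"
  shows "ind (\<Union>I) v = (\<Sum>A\<in>I. ind A v)"
  using assms
proof (induction I)
  case empty
  then show ?case by (simp add: ind_empty)
next
  case (insert A I)
  then have "\<Union>I \<in> \<AA>" "A \<inter> \<Union>I = {}" "disjoint I"
    by (auto simp: disjoint_def)
  then show ?case using insert by (simp add: ind_disjoint_Un)
qed

lemma norm_ind_sq: "A \<in> \<AA> \<Longrightarrow> (norm (ind A v))\<^sup>2 = Re (cinner (ind A v) v)"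
  by (simp add: cinner_projection_self[OF ind_projection])

lemma norm_sq_decompose:
  assumes "A \<in> \<AA>"
  shows "(norm v)\<^sup>2 = (norm (ind A v))\<^sup>2 + (norm (ind (X - A) v))\<^sup>2"
proof -
  have "v = ind A v + ind (X - A) v"
    using fun_cong[OF ind_disjoint_Un[of A "X - A"], of v] assms sets_into_space[OF assms]
    by (simp add: ind_carrier Un_absorb1 compl_sets)
  then have "cinner v v = cinner (ind A v) v + cinner (ind (X - A) v) v"
    by (metis cinner_add_left)
  then show ?thesis using assms
    by (metis norm_ind_sq compl_sets cinner_self Re_complex_of_real plus_complex.sel(1))
qed

lemma norm_ind_le: "A \<in> \<AA> \<Longrightarrow> norm (ind A v) \<le> norm v"
  by (rule power2_le_imp_le) (simp_all add: norm_sq_decompose[of A v])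

lemma norm_ind_Union_sq:
  assumes "finite I" "I \<subseteq> \<AA>" "disjoint I"
  shows "(norm (ind (\<Union>I) v))\<^sup>2 = (\<Sum>A\<in>I. (norm (ind A v))\<^sup>2)"
  using assms
proof (induction I)
  case empty
  then show ?case by (simp add: ind_empty)
next
  case (insert A I)
  then have "\<Union>I \<in> \<AA>" "A \<inter> \<Union>I = {}" "disjoint I"
    by (auto simp: disjoint_def)
  moreover from this have "(norm (ind (\<Union>(insert A I)) v))\<^sup>2 = Re (cinner (ind (A \<union> \<Union>I) v) v)"
    using insert.prems by (simp add: norm_ind_sq Un)
  ultimately show ?case using insert by (simp add: norm_ind_sq ind_disjoint_Un cinner_add_left)
qed

text \<open>Multiplying indicators intersects their sets, and the diagonal in \<open>E\<close> makes
  \<open>A\<close> part of its own thickening, hence disjoint from \<open>A'\<close>.\<close>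

lemma controlled_propagation_ind:
  assumes "U \<in> \<AA>" "Id_on X \<subseteq> E"
  shows "controlled_propagation \<AA> ind E (ind U)"
  unfolding controlled_propagation_def
proof (intro ballI impI)
  fix A A' assume A: "A \<in> \<AA>" "A' \<in> \<AA>" "A' \<inter> thicken E A = {}"
  have "A \<subseteq> thicken E A"
    using sets_into_space[OF A(1)] assms(2) by (force simp: thicken_def)
  then have "A' \<inter> U \<inter> A = {}" using A(3) by blast
  then have "ind A' \<circ> ind U \<circ> ind A = ind {}"
    using A assms by (metis ind_Int Int)
  then show "ind A' \<circ> ind U \<circ> ind A = (\<lambda>_. 0)" by (simp add: ind_empty)
qed

text \<open>The finite partial sums converge to \<open>v\<close>, and exceeding \<open>r\<close>
  strictly is an open condition, so some finite partial sum meets it; Pythagoras splits its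
  norm.\<close>

lemma finite_pieces_exhaust_norm:
  assumes "disjoint P" "P \<subseteq> \<AA>" "((\<lambda>A. ind A v) has_sum v) P" "r < (norm v)\<^sup>2"
  obtains I where "finite I" "I \<subseteq> P" "r < (\<Sum>A\<in>I. (norm (ind A v))\<^sup>2)"
proof -
  have "((\<lambda>I. (norm (\<Sum>A\<in>I. ind A v))\<^sup>2) \<longlongrightarrow> (norm v)\<^sup>2) (finite_subsets_at_top P)"
    using assms(3) unfolding has_sum_def by (intro tendsto_intros)
  then have "\<forall>\<^sub>F I in finite_subsets_at_top P. r < (norm (\<Sum>A\<in>I. ind A v))\<^sup>2"
    using assms(4) by (rule order_tendstoD)
  then obtain I where I: "finite I" "I \<subseteq> P" "r < (norm (\<Sum>A\<in>I. ind A v))\<^sup>2"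
    unfolding eventually_finite_subsets_at_top by blast
  moreover have "I \<subseteq> \<AA>" "disjoint I"
    using I assms(1,2) by (auto intro: pairwise_subset)
  ultimately show ?thesis
    using that by (simp add: norm_ind_Union_sq flip: ind_Union_disjoint)
qed

text \<open>The images under \<open>R\<close> need not be orthogonal, so signs replace Pythagoras.
  The signed sum is a difference of two vectors, one of which has more than half its norm by the
  triangle inequality.\<close>

lemma half_norm_union_of_pieces:
  fixes R :: "'h \<Rightarrow> 'c::complex_hilbert"
  assumes "bounded_linear R" "finite I" "I \<subseteq> \<AA>" "disjoint I"
    and "0 \<le> r" "r\<^sup>2 < (\<Sum>A\<in>I. (norm (R (ind A v)))\<^sup>2)"
  obtains U where "U \<in> \<AA>" "r / 2 < norm (R (ind U v))"
proof -
  interpret R: bounded_linear R by fact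
  obtain S where S: "S \<subseteq> I"
    "(\<Sum>A\<in>I. (norm (R (ind A v)))\<^sup>2)
      \<le> (norm ((\<Sum>A\<in>S. R (ind A v)) - (\<Sum>A\<in>I - S. R (ind A v))))\<^sup>2"
    using exists_signs_sum_norm_sq_le[OF assms(2), of "\<lambda>A. R (ind A v)"] by blast
  have R_Union: "R (ind (\<Union>S') v) = (\<Sum>A\<in>S'. R (ind A v))" and meas: "\<Union>S' \<in> \<AA>"
    if "S' \<subseteq> I" for S'
  proof -
    have "finite S'" "S' \<subseteq> \<AA>" "disjoint S'"
      using that assms finite_subset by (auto intro: pairwise_subset)
    then show "R (ind (\<Union>S') v) = (\<Sum>A\<in>S'. R (ind A v))" "\<Union>S' \<in> \<AA>"
      by (auto simp: ind_Union_disjoint R.sum)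
  qed
  have "r\<^sup>2 < (norm (R (ind (\<Union>S) v) - R (ind (\<Union>(I - S)) v)))\<^sup>2"
    using S assms(6) by (simp only: R_Union Diff_subset)
  then have "r < norm (R (ind (\<Union>S) v) - R (ind (\<Union>(I - S)) v))"
    by (rule power_less_imp_less_base) simp
  also have "\<dots> \<le> norm (R (ind (\<Union>S) v)) + norm (R (ind (\<Union>(I - S)) v))"
    by (rule norm_triangle_ineq4)
  finally consider "r / 2 < norm (R (ind (\<Union>S) v))" | "r / 2 < norm (R (ind (\<Union>(I - S)) v))"
    by linarith
  then show ?thesis using that meas S(1) by cases blast+
qed

end

theorem proposition2p3:
  fixes X :: "'x set" and \<E> :: "('x \<times> 'x) set set" and \<AA> :: "'x set set"
    and indX :: "'x set \<Rightarrow> 'h::complex_hilbert \<Rightarrow> 'h"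
    and Y :: "'y set" and \<F> :: "('y \<times> 'y) set set" and \<BB> :: "'y set set"
    and indY :: "'y set \<Rightarrow> 'k::complex_hilbert \<Rightarrow> 'k"
    and T :: "'h \<Rightarrow> 'k" and Et :: "('x \<times> 'x) set" and F :: "('y \<times> 'y) set"
    and B C :: "'y set" and \<eta> \<delta> \<kappa> :: real
  assumes "coarse_module X \<E> \<AA> indX"
    and "coarse_module Y \<F> \<BB> indY"
    and "discrete_with_gauge X \<E> \<AA> indX Et"
    and "bounded_clinear T"
    and "\<eta> > 0" and "bounded_below \<eta> T"
    and "\<delta> > 0" and "\<kappa> > 0"
    and "F \<in> \<F>"
    and "B \<in> \<BB>" and "C \<in> \<BB>" and "thicken F B \<subseteq> C"
    and "onorm (indY B \<circ> T) \<ge> \<kappa>"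
    and "\<And>A. A \<in> \<AA> \<Longrightarrow> ent_bounded Et A \<Longrightarrow> onorm (indY C \<circ> T \<circ> indX A) \<le> \<delta>"
  shows "\<forall>\<epsilon>>0. \<epsilon> < \<kappa>\<^sup>2 * sqrt (\<eta>\<^sup>2 - \<delta>\<^sup>2) / (2 * onorm T) \<longrightarrow>
    (\<exists>p. is_projection p \<and> controlled_propagation \<AA> indX Et p \<and>
      \<not> quasi_local \<BB> indY \<epsilon> F (T \<circ> p \<circ> cadjoint T))"
proof (intro allI impI)
  fix \<epsilon> :: real
  assume "\<epsilon> > 0" and \<epsilon>: "\<epsilon> < \<kappa>\<^sup>2 * sqrt (\<eta>\<^sup>2 - \<delta>\<^sup>2) / (2 * onorm T)"
  interpret X: coarse_module X \<E> \<AA> indX by fact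
  interpret Y: coarse_module Y \<F> \<BB> indY by fact
  define s where "s = sqrt (\<eta>\<^sup>2 - \<delta>\<^sup>2)"
  have T: "bounded_linear T"
    using \<open>bounded_clinear T\<close> by (simp add: bounded_clinear_def)
  have adj: "cinner (T x) y = cinner x (cadjoint T y)" for x y
    using is_cadjoint_cadjoint[OF \<open>bounded_clinear T\<close>] by (simp add: is_cadjoint_def)
  have ind_BL: "bounded_linear (indX A)" if "A \<in> \<AA>" for A
    using that X.ind_projection is_projection_bounded_linear by blast
  have indY_BL: "bounded_linear (indY A)" if "A \<in> \<BB>" for A
    using that Y.ind_projection is_projection_bounded_linear by blast

  have "\<kappa> \<le> onorm T"
  proof -
    have "onorm (indY B \<circ> T) \<le> onorm T"
      by (rule onorm_bound[OF onorm_pos_le[OF T]])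
        (metis Y.norm_ind_le[OF \<open>B \<in> \<BB>\<close>] comp_apply onorm[OF T] order_trans)
    then show ?thesis using assms(13) by linarith
  qed
  then have "0 < onorm T" using \<open>\<kappa> > 0\<close> by linarith
  \<comment> \<open>\<open>sqrt\<close> is negative at negative reals, so a positive \<epsilon>
    below the bound forces \<delta> < \<eta>.\<close>
  have "0 < \<kappa>\<^sup>2 * s / (2 * onorm T)" using \<epsilon> \<open>\<epsilon> > 0\<close> by (simp add: s_def)
  then have s: "s > 0"
    using \<open>0 < onorm T\<close> \<open>\<kappa> > 0\<close> by (simp add: zero_less_divide_iff zero_less_mult_iff)
  then have s_sq: "s\<^sup>2 = \<eta>\<^sup>2 - \<delta>\<^sup>2" by (simp add: s_def)
  \<comment> \<open>Chosen so that \<open>s * \<kappa>' / 2 = \<epsilon>\<close>, the final lower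
    bound. It lies below \<kappa> because \<open>\<kappa> / onorm T \<le> 1\<close>.\<close>
  define \<kappa>' where "\<kappa>' = 2 * \<epsilon> / s"
  have "\<kappa>' > 0" using s \<open>\<epsilon> > 0\<close> by (simp add: \<kappa>'_def)
  have "\<kappa>' < \<kappa>"
  proof -
    have "\<kappa>\<^sup>2 * s / (2 * onorm T) = (\<kappa> * s / 2) * (\<kappa> / onorm T)"
      by (simp add: power2_eq_square)
    also have "\<dots> \<le> \<kappa> * s / 2"
      using \<open>\<kappa> \<le> onorm T\<close> \<open>0 < onorm T\<close> \<open>\<kappa> > 0\<close> s by (intro mult_left_le) auto
    finally have "\<epsilon> < \<kappa> * s / 2" using \<epsilon> unfolding s_def by linarith
    then show ?thesis using s by (simp add: \<kappa>'_def field_simps)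
  qed

  obtain x where x: "\<kappa>' * norm x < norm (indY B (T x))"
  proof -
    have "\<not> (\<forall>x. norm ((indY B \<circ> T) x) \<le> \<kappa>' * norm x)"
      using onorm_bound[of \<kappa>' "indY B \<circ> T"] \<open>0 < \<kappa>'\<close> \<open>\<kappa>' < \<kappa>\<close> assms(13) by force
    then show ?thesis using that by (auto simp: not_le)
  qed
  define w where "w = indY B (T x)"
  define u where "u = cadjoint T w"
  have w: "indY B w = w"
    using Y.ind_Int[OF \<open>B \<in> \<BB>\<close> \<open>B \<in> \<BB>\<close>] by (metis Int_absorb comp_apply w_def)
  have "norm w > 0"
    using x \<open>\<kappa>' > 0\<close> unfolding w_def
    by (meson le_less_trans less_imp_le mult_nonneg_nonneg norm_ge_zero)
  \<comment> \<open>Moving \<open>T\<close> across the form bounds \<open>(norm w)\<^sup>2\<close>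
    by \<open>norm x * norm u\<close>, while \<open>norm x\<close> is less than
    \<open>norm w / \<kappa>'\<close>.\<close>
  have "\<kappa>' * norm w < norm u"
  proof -
    have "(norm w)\<^sup>2 = Re (cinner x u)"
      using Y.norm_ind_sq[OF \<open>B \<in> \<BB>\<close>, of "T x"]
      by (simp add: w_def u_def Re_cinner_commute flip: adj)
    also have "\<dots> \<le> norm x * norm u" by (rule Re_cinner_le)
    finally have w_sq: "(norm w)\<^sup>2 \<le> norm x * norm u" .
    then have "norm u > 0"
      using \<open>norm w > 0\<close> by (metis norm_ge_zero less_eq_real_def mult_zero_right not_le
          zero_less_power)
    have "norm w * (\<kappa>' * norm w) = \<kappa>' * (norm w)\<^sup>2" by (simp add: power2_eq_square)
    also have "\<dots> \<le> (\<kappa>' * norm x) * norm u" using w_sq \<open>\<kappa>' > 0\<close> by simp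
    also have "\<dots> < norm w * norm u" using x \<open>norm u > 0\<close> by (simp add: w_def)
    finally show ?thesis using \<open>norm w > 0\<close> by simp
  qed
  then have u: "(\<kappa>' * norm w)\<^sup>2 < (norm u)\<^sup>2"
    using \<open>\<kappa>' > 0\<close> by (intro power_strict_mono) auto

  obtain P where P: "partition_on X P" "P \<subseteq> \<AA>" "\<And>A. A \<in> P \<Longrightarrow> ent_bounded Et A"
    "((\<lambda>A. indX A u) has_sum u) P"
    using assms(3) unfolding discrete_with_gauge_def by (elim conjE exE) simp
  have "Id_on X \<subseteq> Et"
    using assms(3) by (simp add: discrete_with_gauge_def coarse_gauge_def)
  have "disjoint P" using P(1) by (simp add: partition_on_def)
  obtain I where I: "finite I" "I \<subseteq> P" "(\<kappa>' * norm w)\<^sup>2 < (\<Sum>A\<in>I. (norm (indX A u))\<^sup>2)"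
    using X.finite_pieces_exhaust_norm[OF \<open>disjoint P\<close> P(2,4) u] .

  define D where "D = Y - C"
  have "D \<in> \<BB>" using \<open>C \<in> \<BB>\<close> by (simp add: D_def Y.compl_sets)
  have piece: "s\<^sup>2 * (norm (indX A u))\<^sup>2 \<le> (norm (indY D (T (indX A u))))\<^sup>2" if "A \<in> P" for A
  proof -
    define a where "a = indX A u"
    have "A \<in> \<AA>" using that P(2) by blast
    then have a: "indX A a = a"
      using X.ind_Int[of A A] by (metis Int_absorb comp_apply a_def)
    have bl: "bounded_linear (indY C \<circ> T \<circ> indX A)"
      unfolding comp_def
      by (intro bounded_linear_compose[OF indY_BL] bounded_linear_compose[OF T] ind_BL) fact+
    have "norm (indY C (T a)) \<le> onorm (indY C \<circ> T \<circ> indX A) * norm a"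
      using onorm[OF bl, of a] a by simp
    also have "\<dots> \<le> \<delta> * norm a"
      using assms(14)[OF \<open>A \<in> \<AA>\<close> P(3)[OF that]] by (rule mult_right_mono) simp
    finally have "(norm (indY C (T a)))\<^sup>2 \<le> (\<delta> * norm a)\<^sup>2" by (rule power_mono) simp
    moreover have "(\<eta> * norm a)\<^sup>2 \<le> (norm (T a))\<^sup>2"
      using \<open>bounded_below \<eta> T\<close> \<open>\<eta> > 0\<close> by (intro power_mono) (auto simp: bounded_below_def)
    ultimately show ?thesis
      using Y.norm_sq_decompose[OF \<open>C \<in> \<BB>\<close>, of "T a"]
      by (simp add: s_sq a_def D_def power_mult_distrib algebra_simps)
  qed
  have "(s * (\<kappa>' * norm w))\<^sup>2 < (\<Sum>A\<in>I. s\<^sup>2 * (norm (indX A u))\<^sup>2)"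
    using I(3) s by (simp add: power_mult_distrib flip: sum_distrib_left)
  also have "\<dots> \<le> (\<Sum>A\<in>I. (norm ((indY D \<circ> T) (indX A u)))\<^sup>2)"
    using I(2) piece by (intro sum_mono) auto
  finally have big: "(s * (\<kappa>' * norm w))\<^sup>2 < \<dots>" .
  have bl: "bounded_linear (indY D \<circ> T)"
    unfolding comp_def by (intro bounded_linear_compose[OF indY_BL] T) fact
  have "I \<subseteq> \<AA>" "disjoint I" "0 \<le> s * (\<kappa>' * norm w)"
    using I(2) \<open>disjoint P\<close> P(2) s \<open>\<kappa>' > 0\<close> by (auto intro: pairwise_subset)
  from X.half_norm_union_of_pieces[OF bl I(1) this big]
  obtain U where U: "U \<in> \<AA>" "s * (\<kappa>' * norm w) / 2 < norm ((indY D \<circ> T) (indX U u))" .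

  have "\<not> quasi_local \<BB> indY \<epsilon> F (T \<circ> indX U \<circ> cadjoint T)"
  proof
    \<comment> \<open>The witness against quasi-locality is \<open>w\<close>: \<open>indY B\<close>
      fixes it, so \<open>?Q w\<close> is the vector \<open>indY D (T (indX U u))\<close> just
      bounded from below.\<close>
    let ?Q = "indY D \<circ> (T \<circ> indX U \<circ> cadjoint T) \<circ> indY B"
    assume "quasi_local \<BB> indY \<epsilon> F (T \<circ> indX U \<circ> cadjoint T)"
    moreover have "D \<inter> thicken F B = {}" using \<open>thicken F B \<subseteq> C\<close> by (auto simp: D_def)
    ultimately have "onorm ?Q \<le> \<epsilon>"
      using \<open>B \<in> \<BB>\<close> \<open>D \<in> \<BB>\<close> unfolding quasi_local_def by blast
    moreover have "bounded_linear ?Q"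
      unfolding comp_def
      by (intro bounded_linear_compose[OF indY_BL] bounded_linear_compose[OF T]
          bounded_linear_compose[OF ind_BL]
          bounded_linear_compose[OF bounded_linear_cadjoint[OF \<open>bounded_clinear T\<close>]] indY_BL) fact+
    ultimately have "norm (?Q w) \<le> \<epsilon> * norm w"
      by (meson mult_right_mono norm_ge_zero onorm order_trans)
    moreover have "s * (\<kappa>' * norm w) / 2 = \<epsilon> * norm w" using s by (simp add: \<kappa>'_def)
    ultimately show False using U(2) unfolding comp_apply w u_def by linarith
  qed
  then show "\<exists>p. is_projection p \<and> controlled_propagation \<AA> indX Et p \<and>
      \<not> quasi_local \<BB> indY \<epsilon> F (T \<circ> p \<circ> cadjoint T)"
    using X.ind_projection X.controlled_propagation_ind U(1) \<open>Id_on X \<subseteq> Et\<close> by blast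
qed

end
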